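(* (Local sublinear convergence.) In the setting fixed in the context, suppose that $\phi$ is $\sigma$-strongly convex ($\sigma>0$) and that $f$ is $\rho$-weakly convex and satisfies the local $\mu$-quadratic growth condition with $\zeta>0$. Let $\nu\in(0,1]$ and let $D=\sqrt{\sup_{x,y\in P}D_\phi(x,y)}$ be the diameter of $P$ characterized by the Bregman distance $D_\phi$. Consider the iterates $(x_t)$ of the Frank--Wolfe algorithm with the open loop step-size $\gamma_t=\frac2{2+t}$. Then, if $\rho/\sigma\le L$ and $\frac{3\rho}{\mu}\le2-\nu$ hold, for all $t\ge1$, $$f(x_t)-f^*\le\frac{2^{1+\nu}\mu LD^2}{\rho(t+2)^\nu},$$ and hence for any accuracy $\epsilon>0$ we have $f(x_t)-f^*\le\epsilon$ for all $t\ge\left(2^{1+\nu}\mu LD^2/(\rho\epsilon)\right)^{1/\nu}$.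
   Context: Setting. $C\subset\mathbb R^n$ is a nonempty open convex set. A kernel generating distance associated with $C$ is a proper lower semicontinuous convex function $\phi:\mathbb R^n\to(-\infty,+\infty]$ with $\operatorname{dom}\phi\subset\operatorname{cl}C$, $\operatorname{dom}\partial\phi=C$, and $\phi$ of class $C^1$ on $\operatorname{int}\operatorname{dom}\phi= C$. The Bregman distance is $D_\phi(x,y)=\phi(x)-\phi(y)-\langle\nabla\phi(y),x-y\rangle$. Standing assumptions: (i) $\phi$ is a kernel generating distance associated with $C$, $\operatorname{cl}C=\operatorname{cl}\operatorname{dom}\phi$, $\phi$ is strictly convex on $C$, and $\nu>0$ satisfies $D_\phi((1-\gamma)x+\gamma y,x)\le\gamma^{1+\nu}D_\phi(y,x)$ for all $x,y\in C$, $\gamma\in[0,1]$; (ii) $f:\mathbb R^n\to(-\infty,+\infty]$ is proper, lower semicontinuous, $\operatorname{dom}\phi\subset\operatorname{dom}f$, and $f$ is $C^1$ on $C$; (iii) the pair $(f,\phi)$ is $L$-smooth adaptable on $P$: $L>0$ and both $L\phi-f$ and $L\phi+f$ are convex on $P$; (iv) $P\subset\mathbb R^n$ is a nonempty compact convex set with $P\subset C$. Write $f^*=\min_{x\in P}f(x)$. $f$ is $\rho$-weakly convex ($\rho>0$) if $f+\frac\rho2\|\cdot\|^2$ is convex. With $\mathcal X^*=\operatorname{argmin}_{x\in P}f(x)$, $f$ satisfies local $\mu$-quadratic growth with $\zeta>0$ ($\mu>0$) if $\operatorname{dist}(x,\mathcal X^* )^2\le\frac2\mu(f(x)-f^* )$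 for all $x\in P$ with $f(x)\le f^*+\zeta$. Frank--Wolfe algorithm: given $x_0\in P$, for $t=0,1,\dots$ pick $v_t\in\operatorname{argmin}_{v\in P}\langle\nabla f(x_t),v\rangle$, a step-size $\gamma_t\in[0,1]$, and set $x_{t+1}=(1-\gamma_t)x_t+\gamma_tv_t$.
   Formalization: The formal theorem additionally assumes f(x_t) ≤ f*+ζ for all t≥1 (iterates stay where local growth applies); without it the claim fails, e.g. P=[-1,2], φ=x²/2, f=-x²/2, ν=L=σ=ρ=1, μ=3, ζ=1, x_0=-1, where the gap stays 3/2. *)

theory Defs
  imports "HOL-Analysis.Analysis"
begin

section \<open>Extended-real-valued functions\<close>

definition edom :: "('a \<Rightarrow> ereal) \<Rightarrow> 'a set" where
  "edom g = {x. g x < \<infinity>}"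

definition proper :: "('a \<Rightarrow> ereal) \<Rightarrow> bool" where
  "proper g \<longleftrightarrow> (\<forall>x. g x \<noteq> -\<infinity>) \<and> edom g \<noteq> {}"

definition lsc :: "('a::topological_space \<Rightarrow> ereal) \<Rightarrow> bool" where
  "lsc g \<longleftrightarrow> (\<forall>x. g x \<le> Liminf (at x) g)"

text \<open>Only meaningful for functions that never take the value \<open>-\<infinity>\<close>: then no \<open>\<infinity> - \<infinity>\<close> occurs on
  the right, and since \<open>0 * \<infinity> = 0\<close> in \<^typ>\<open>ereal\<close> the cases \<open>t = 0\<close> and \<open>t = 1\<close> are trivial.\<close>

definition econvex :: "('a::real_vector \<Rightarrow> ereal) \<Rightarrow> bool" where
  "econvex g \<longleftrightarrow> (\<forall>x y. \<forall>t\<in>{0..1::real}.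
     g ((1 - t) *\<^sub>R x + t *\<^sub>R y) \<le> ereal (1 - t) * g x + ereal t * g y)"

definition strictly_econvex_on :: "'a::real_vector set \<Rightarrow> ('a \<Rightarrow> ereal) \<Rightarrow> bool" where
  "strictly_econvex_on S g \<longleftrightarrow> (\<forall>x\<in>S. \<forall>y\<in>S. \<forall>t\<in>{0<..<1::real}. x \<noteq> y \<longrightarrow>
     g ((1 - t) *\<^sub>R x + t *\<^sub>R y) < ereal (1 - t) * g x + ereal t * g y)"

definition strongly_econvex :: "real \<Rightarrow> ('a::real_normed_vector \<Rightarrow> ereal) \<Rightarrow> bool" where
  "strongly_econvex \<sigma> g \<longleftrightarrow> econvex (\<lambda>x. g x - ereal (\<sigma> / 2 * (norm x)\<^sup>2))"

definition weakly_econvex :: "real \<Rightarrow> ('a::real_normed_vector \<Rightarrow> ereal) \<Rightarrow> bool" where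
  "weakly_econvex \<rho> g \<longleftrightarrow> econvex (\<lambda>x. g x + ereal (\<rho> / 2 * (norm x)\<^sup>2))"

definition subdifferential :: "('a::real_inner \<Rightarrow> ereal) \<Rightarrow> 'a \<Rightarrow> 'a set" where
  "subdifferential g x =
     {u. \<bar>g x\<bar> \<noteq> \<infinity> \<and> (\<forall>y. g x + ereal (u \<bullet> (y - x)) \<le> g y)}"

text \<open>Differentiability at a point only sees \<open>g\<close> near that point, so \<^const>\<open>real_of_ereal\<close> is harmless
  in the interior of the domain, which is where these notions are used.\<close>

definition egrad :: "('a::real_inner \<Rightarrow> ereal) \<Rightarrow> 'a \<Rightarrow> 'a" where
  "egrad g x = (THE d. GDERIV (\<lambda>y. real_of_ereal (g y)) x :> d)"

definition C1_on :: "'a::real_inner set \<Rightarrow> ('a \<Rightarrow> ereal) \<Rightarrow> bool" where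
  "C1_on S g \<longleftrightarrow> open S \<and> (\<forall>x\<in>S. \<bar>g x\<bar> \<noteq> \<infinity>) \<and>
     (\<forall>x\<in>S. \<exists>d. GDERIV (\<lambda>y. real_of_ereal (g y)) x :> d) \<and> continuous_on S (egrad g)"


section \<open>Bregman distances and smooth adaptability\<close>

definition kernel_generating_distance :: "'a::euclidean_space set \<Rightarrow> ('a \<Rightarrow> ereal) \<Rightarrow> bool" where
  "kernel_generating_distance C \<phi> \<longleftrightarrow>
     proper \<phi> \<and> lsc \<phi> \<and> econvex \<phi> \<and>
     edom \<phi> \<subseteq> closure C \<and> {x. subdifferential \<phi> x \<noteq> {}} = C \<and>
     interior (edom \<phi>) = C \<and> C1_on (interior (edom \<phi>)) \<phi>"

text \<open>Intended for \<open>x\<close> in the domain of \<open>\<phi>\<close> and \<open>y\<close> in its interior; the value is a junk real otherwise.\<close>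

definition bregman :: "('a::real_inner \<Rightarrow> ereal) \<Rightarrow> 'a \<Rightarrow> 'a \<Rightarrow> real" where
  "bregman \<phi> x y = real_of_ereal (\<phi> x) - real_of_ereal (\<phi> y) - egrad \<phi> y \<bullet> (x - y)"

definition bregman_diameter :: "('a::real_inner \<Rightarrow> ereal) \<Rightarrow> 'a set \<Rightarrow> real" where
  "bregman_diameter \<phi> P = sqrt (SUP (x, y) \<in> P \<times> P. bregman \<phi> x y)"

text \<open>Intended for \<open>P\<close> contained in the domains of \<open>f\<close> and \<open>\<phi>\<close>.\<close>

definition smooth_adaptable_on ::
    "'a::real_vector set \<Rightarrow> real \<Rightarrow> ('a \<Rightarrow> ereal) \<Rightarrow> ('a \<Rightarrow> ereal) \<Rightarrow> bool" where
  "smooth_adaptable_on P L f \<phi> \<longleftrightarrow>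
     convex_on P (\<lambda>x. L * real_of_ereal (\<phi> x) - real_of_ereal (f x)) \<and>
     convex_on P (\<lambda>x. L * real_of_ereal (\<phi> x) + real_of_ereal (f x))"


section \<open>Constrained minimisation and the Frank--Wolfe algorithm\<close>

text \<open>The infimum is attained for \<open>P\<close> nonempty compact and \<open>f\<close> lower semicontinuous.\<close>

definition min_value :: "('a \<Rightarrow> ereal) \<Rightarrow> 'a set \<Rightarrow> ereal" where
  "min_value f P = (INF x\<in>P. f x)"

definition minimizers :: "('a \<Rightarrow> 'b::order) \<Rightarrow> 'a set \<Rightarrow> 'a set" where
  "minimizers g P = {x. is_arg_min g (\<lambda>y. y \<in> P) x}"

definition local_quadratic_growth ::
    "real \<Rightarrow> real \<Rightarrow> ('a::metric_space \<Rightarrow> ereal) \<Rightarrow> 'a set \<Rightarrow> bool" where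
  "local_quadratic_growth \<mu> \<zeta> f P \<longleftrightarrow>
     (\<forall>x\<in>P. f x \<le> min_value f P + ereal \<zeta> \<longrightarrow>
        ereal ((infdist x (minimizers f P))\<^sup>2) \<le> ereal (2 / \<mu>) * (f x - min_value f P))"

definition frank_wolfe ::
    "('a::real_inner \<Rightarrow> ereal) \<Rightarrow> 'a set \<Rightarrow> (nat \<Rightarrow> real) \<Rightarrow> (nat \<Rightarrow> 'a) \<Rightarrow> (nat \<Rightarrow> 'a) \<Rightarrow> bool" where
  "frank_wolfe f P \<gamma> x v \<longleftrightarrow> x 0 \<in> P \<and>
     (\<forall>t. v t \<in> minimizers (\<lambda>w. egrad f (x t) \<bullet> w) P \<and> \<gamma> t \<in> {0..1} \<and>
          x (Suc t) = (1 - \<gamma> t) *\<^sub>R x t + \<gamma> t *\<^sub>R v t)"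

end

theory Submission
  imports Defs
begin

text \<open>Smooth adaptability gives the descent inequality, and weak convexity together with quadratic
  growth bounds the Frank--Wolfe gap below by \<open>(1 - \<rho> / \<mu>) (f x - f\<^sup>*)\<close>, hence
  \<open>h\<^sub>t\<^sub>+\<^sub>1 \<le> (1 - (1 - \<rho> / \<mu>) \<gamma>\<^sub>t) h\<^sub>t + L \<gamma>\<^sub>t\<^sup>1\<^sup>+\<^sup>\<nu> D\<^sup>2\<close>. The rate follows by induction on \<open>t\<close>. For the base
  case, \<open>\<gamma>\<^sub>0 = 1\<close> and \<open>\<rho> / \<sigma> \<le> L\<close> give \<open>h\<^sub>1 \<le> 2 L D\<^sup>2\<close> whatever \<open>x\<^sub>0\<close> is.\<close>

section \<open>Gradients and tangent inequalities\<close>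

text \<open>Along the segment from \<open>y\<close> to \<open>x\<close>, convexity bounds the
  difference quotients at \<open>y\<close> by \<open>g x - g y\<close>, and their limit from the
  right is the directional derivative. The gradient is that of \<open>g\<close> on the whole space,
  so \<open>S\<close> may be a set with empty interior, such as \<open>P\<close>.\<close>

lemma convex_on_above_tangent:
  fixes g :: "'a::real_inner \<Rightarrow> real"
  assumes "convex_on S g" "x \<in> S" "y \<in> S" "GDERIV g y :> d"
  shows "g y + d \<bullet> (x - y) \<le> g x"
proof -
  let ?l = "\<lambda>s::real. y + s *\<^sub>R (x - y)"
  have "((g \<circ> ?l) has_derivative (\<lambda>h. (h *\<^sub>R (x - y)) \<bullet> d)) (at 0)"
    using assms(4) unfolding o_def gderiv_def
    by (intro has_derivative_compose[of ?l _ 0 UNIV g, simplified])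
       (auto intro!: derivative_eq_intros)
  then have "((g \<circ> ?l) has_field_derivative d \<bullet> (x - y)) (at 0)"
    by (simp add: has_field_derivative_def inner_commute mult_commute_abs)
  then have "((\<lambda>s. (g (?l s) - g y) / s) \<longlongrightarrow> d \<bullet> (x - y)) (at_right 0)"
    by (auto simp: DERIV_def intro: tendsto_within_subset)
  moreover have "\<forall>\<^sub>F s in at_right 0. (g (?l s) - g y) / s \<le> g x - g y"
    unfolding eventually_at_right_field
  proof (intro exI[of _ 1] conjI allI impI)
    fix s :: real
    assume s: "0 < s" "s < 1"
    have "?l s = (1 - s) *\<^sub>R y + s *\<^sub>R x"
      by (simp add: algebra_simps)
    then have "g (?l s) \<le> (1 - s) * g y + s * g x"
      using convex_onD[OF assms(1), of s y x] s assms by simp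
    then show "(g (?l s) - g y) / s \<le> g x - g y"
      using s by (simp add: field_simps)
  qed simp
  ultimately have "d \<bullet> (x - y) \<le> g x - g y"
    by (rule tendsto_upperbound) simp
  then show ?thesis by simp
qed

lemma econvex_imp_convex_on:
  assumes "econvex g" "convex S" "\<And>x. x \<in> S \<Longrightarrow> g x = ereal (G x)"
  shows "convex_on S G"
proof (rule convex_onI)
  fix t :: real and x y
  assume t: "0 < t" "t < 1" and xy: "x \<in> S" "y \<in> S"
  then have "(1 - t) *\<^sub>R x + t *\<^sub>R y \<in> S"
    using assms(2) by (simp add: convex_alt)
  moreover have "g ((1 - t) *\<^sub>R x + t *\<^sub>R y) \<le> ereal (1 - t) * g x + ereal t * g y"
    using assms(1) t by (auto simp: econvex_def)
  ultimately show "G ((1 - t) *\<^sub>R x + t *\<^sub>R y) \<le> (1 - t) * G x + t * G y"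
    using xy assms(3) by simp
qed (rule assms(2))

lemma GDERIV_half_norm_square:
  "GDERIV (\<lambda>x. c / 2 * (norm x)\<^sup>2) x :> c *\<^sub>R x"
  unfolding gderiv_def power2_norm_eq_inner
  by (auto intro!: derivative_eq_intros simp: inner_commute algebra_simps)

text \<open>\<open>egrad\<close> is a definite description, so uniqueness has to be shown: two
  gradients represent the same derivative, and the inner product separates vectors.\<close>

lemma C1_on_GDERIV:
  assumes "C1_on S g" "x \<in> S"
  shows "GDERIV (\<lambda>y. real_of_ereal (g y)) x :> egrad g x"
proof -
  obtain d where d: "GDERIV (\<lambda>y. real_of_ereal (g y)) x :> d"
    using assms by (auto simp: C1_on_def)
  have "e = d" if "GDERIV (\<lambda>y. real_of_ereal (g y)) x :> e" for e
  proof -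
    have "(\<lambda>h. h \<bullet> e) = (\<lambda>h. h \<bullet> d)"
      using has_derivative_unique that d unfolding gderiv_def by blast
    then show ?thesis by (metis vector_eq_ldot)
  qed
  then show ?thesis unfolding egrad_def using d by (metis theI)
qed

lemma C1_on_ereal:
  "C1_on S g \<Longrightarrow> x \<in> S \<Longrightarrow> g x = ereal (real_of_ereal (g x))"
  by (auto simp: C1_on_def ereal_real)

lemma C1_on_continuous_on:
  assumes "C1_on S g"
  shows "continuous_on S (\<lambda>y. real_of_ereal (g y))"
  using C1_on_GDERIV[OF assms] unfolding gderiv_def
  by (meson continuous_at_imp_continuous_on has_derivative_continuous)

text \<open>The tangent inequality is applied to the convex function obtained by adding the
  quadratic; the quadratic terms then combine into a multiple of
  \<open>(norm (x - y))\<^sup>2\<close>. The modulus may have either sign, so strong convexity is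
  covered as well.\<close>

lemma weakly_econvex_above_tangent:
  assumes "weakly_econvex \<rho> f" "C1_on S f" "convex S" "x \<in> S" "y \<in> S"
  shows "real_of_ereal (f y) + egrad f y \<bullet> (x - y) - \<rho> / 2 * (norm (x - y))\<^sup>2
    \<le> real_of_ereal (f x)"
proof -
  let ?g = "\<lambda>x. real_of_ereal (f x) + \<rho> / 2 * (norm x)\<^sup>2"
  have "convex_on S ?g"
    using assms(1) assms(3) unfolding weakly_econvex_def
  proof (rule econvex_imp_convex_on)
    fix z assume "z \<in> S"
    then show "f z + ereal (\<rho> / 2 * (norm z)\<^sup>2) = ereal (?g z)"
      using C1_on_ereal[OF assms(2), of z] by (metis plus_ereal.simps(1))
  qed
  moreover have "GDERIV ?g y :> egrad f y + \<rho> *\<^sub>R y"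
    by (intro GDERIV_add C1_on_GDERIV[OF assms(2)] GDERIV_half_norm_square assms)
  ultimately have "?g y + (egrad f y + \<rho> *\<^sub>R y) \<bullet> (x - y) \<le> ?g x"
    using assms by (intro convex_on_above_tangent)
  moreover have "\<rho> / 2 * (norm y)\<^sup>2 + \<rho> * (y \<bullet> (x - y)) = \<rho> / 2 * (norm x)\<^sup>2 - \<rho> / 2 * (norm (x - y))\<^sup>2"
    by (simp add: power2_norm_eq_inner inner_diff inner_commute algebra_simps)
  ultimately show ?thesis by (simp add: inner_add_left)
qed

text \<open>Strong convexity is weak convexity with modulus \<open>- \<sigma>\<close>, and the
  Bregman distance is exactly the gap in the tangent inequality.\<close>

lemma strongly_econvex_bregman_ge:
  assumes "strongly_econvex \<sigma> \<phi>" "C1_on S \<phi>" "convex S" "x \<in> S" "y \<in> S"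
  shows "\<sigma> / 2 * (norm (x - y))\<^sup>2 \<le> bregman \<phi> x y"
proof -
  have "weakly_econvex (- \<sigma>) \<phi>"
    using assms(1) by (simp add: strongly_econvex_def weakly_econvex_def minus_ereal_def)
  from weakly_econvex_above_tangent[OF this assms(2-)] show ?thesis
    by (simp add: bregman_def)
qed

text \<open>This is the tangent inequality at \<open>y\<close> of the convex function
  \<open>L \<phi> - f\<close>, solved for \<open>f x\<close>; the terms in \<open>\<phi>\<close>
  collect into the Bregman distance.\<close>

lemma smooth_adaptable_descent:
  assumes "smooth_adaptable_on P L f \<phi>" "C1_on C f" "C1_on C \<phi>" "P \<subseteq> C" "x \<in> P" "y \<in> P"
  shows "real_of_ereal (f x) \<le> real_of_ereal (f y) + egrad f y \<bullet> (x - y) + L * bregman \<phi> x y"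
proof -
  let ?g = "\<lambda>x. L * real_of_ereal (\<phi> x) - real_of_ereal (f x)"
  have df: "GDERIV (\<lambda>y. real_of_ereal (f y)) y :> egrad f y"
    and dp: "GDERIV (\<lambda>y. real_of_ereal (\<phi> y)) y :> egrad \<phi> y"
    using assms by (auto intro!: C1_on_GDERIV)
  have "GDERIV ?g y :> L *\<^sub>R egrad \<phi> y - egrad f y"
    using df dp unfolding gderiv_def
    by (auto intro!: derivative_eq_intros simp: inner_diff_right)
  moreover have "convex_on P ?g"
    using assms(1) by (simp add: smooth_adaptable_on_def)
  ultimately have "?g y + (L *\<^sub>R egrad \<phi> y - egrad f y) \<bullet> (x - y) \<le> ?g x"
    using assms by (intro convex_on_above_tangent)
  then show ?thesis
    by (simp add: bregman_def algebra_simps inner_diff_left)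
qed

section \<open>The Bregman diameter\<close>

text \<open>The supremum in \<open>bregman_diameter\<close> is a real one, so it bounds its members
  only once boundedness is known. Here the Bregman distance is continuous on the compact set
  \<open>P \<times> P\<close>.\<close>

lemma bdd_above_bregman:
  assumes "C1_on C \<phi>" "compact P" "P \<subseteq> C"
  shows "bdd_above ((\<lambda>(x, y). bregman \<phi> x y) ` (P \<times> P))"
proof -
  have p: "continuous_on P (\<lambda>y. real_of_ereal (\<phi> y))"
    using C1_on_continuous_on[OF assms(1)] assms(3) continuous_on_subset by blast
  have g: "continuous_on P (egrad \<phi>)"
    using assms(1,3) continuous_on_subset by (auto simp: C1_on_def)
  have "continuous_on (P \<times> P) (\<lambda>z. bregman \<phi> (fst z) (snd z))"
    unfolding bregman_def
    by (intro continuous_intros continuous_on_compose2[OF p] continuous_on_compose2[OF g]) auto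
  then have "compact ((\<lambda>z. bregman \<phi> (fst z) (snd z)) ` (P \<times> P))"
    using assms(2) by (intro compact_continuous_image compact_Times)
  then show ?thesis
    by (simp add: case_prod_beta' compact_imp_bounded bounded_imp_bdd_above)
qed

lemma bregman_le_diameter_square:
  assumes "bdd_above ((\<lambda>(x, y). bregman \<phi> x y) ` (P \<times> P))" "x \<in> P" "y \<in> P"
  shows "bregman \<phi> x y \<le> (bregman_diameter \<phi> P)\<^sup>2"
proof -
  let ?S = "SUP (x, y) \<in> P \<times> P. bregman \<phi> x y"
  have le: "bregman \<phi> x y \<le> ?S" if "x \<in> P" "y \<in> P" for x y
    using cSUP_upper[OF _ assms(1), of "(x, y)"] that by simp
  \<comment> \<open>The Bregman distance vanishes on the diagonal, so the supremum is nonnegative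
    and squaring undoes the square root.\<close>
  have "0 \<le> ?S"
    using le[OF assms(2,2)] by (simp add: bregman_def)
  then show ?thesis
    using le[OF assms(2,3)] by (simp add: bregman_diameter_def)
qed

section \<open>The scalar recursion\<close>

text \<open>Multiplied by \<open>(s + 1) powr \<nu>\<close>, the claim reads
  \<open>(1 - \<nu> / s) * (1 + 1 / s) powr \<nu> \<le> 1\<close>. Bernoulli's inequality bounds the
  second factor by \<open>1 + \<nu> / s\<close>, and the product becomes a difference of
  squares.\<close>

lemma inverse_powr_step:
  fixes \<nu> s :: real
  assumes "0 \<le> \<nu>" "\<nu> \<le> 1" "0 < s"
  shows "(1 - \<nu> / s) / s powr \<nu> \<le> 1 / (s + 1) powr \<nu>"
proof -
  have pos: "0 < 1 + 1 / s"
    using assms by (intro add_pos_pos) auto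
  have b: "(1 + 1 / s) powr \<nu> \<le> 1 + \<nu> / s"
  proof -
    \<comment> \<open>Young's inequality with second factor 1 is Bernoulli's inequality for
      exponents in [0, 1].\<close>
    have "(1 + 1 / s) powr \<nu> * 1 powr (1 - \<nu>) \<le> \<nu> * (1 + 1 / s) + (1 - \<nu>) * 1"
      using assms pos by (intro Youngs_inequality_0) auto
    then show ?thesis by (simp add: algebra_simps)
  qed
  have "s + 1 = s * (1 + 1 / s)"
    using assms by (simp add: algebra_simps)
  then have e: "(s + 1) powr \<nu> = s powr \<nu> * (1 + 1 / s) powr \<nu>"
    using assms pos by (simp add: powr_mult)
  have "(1 - \<nu> / s) * (1 + 1 / s) powr \<nu> \<le> 1"
  proof (cases "1 - \<nu> / s \<ge> 0")
    case True
    then have "(1 - \<nu> / s) * (1 + 1 / s) powr \<nu> \<le> (1 - \<nu> / s) * (1 + \<nu> / s)"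
      by (intro mult_left_mono b)
    also have "\<dots> = 1 - (\<nu> / s)\<^sup>2"
      by (simp add: algebra_simps power2_eq_square)
    finally show ?thesis by (smt (verit) zero_le_power2)
  next
    case False
    then show ?thesis by (smt (verit) mult_nonpos_nonneg powr_ge_zero)
  qed
  moreover have "0 < s powr \<nu>" "0 < (1 + 1 / s) powr \<nu>"
    using assms pos by simp_all
  ultimately show ?thesis
    unfolding e by (simp add: divide_simps mult.assoc split: if_splits)
qed

text \<open>In the application \<open>\<kappa> = \<rho> / \<mu>\<close> and \<open>B = L D\<^sup>2\<close>.\<close>

lemma open_loop_recursion:
  fixes h :: "nat \<Rightarrow> real" and \<nu> \<kappa> B :: real
  assumes nu: "0 < \<nu>" "\<nu> \<le> 1" and k: "0 < \<kappa>" "3 * \<kappa> \<le> 2 - \<nu>" and B: "0 \<le> B"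
    and base: "h 1 \<le> 2 * B"
    and step: "\<And>t. 1 \<le> t \<Longrightarrow>
      h (Suc t) \<le> (1 - (1 - \<kappa>) * (2 / (2 + real t))) * h t + (2 / (2 + real t)) powr (1 + \<nu>) * B"
    and t: "1 \<le> t"
  shows "h t \<le> 2 powr (1 + \<nu>) * B / \<kappa> / (real t + 2) powr \<nu>"
  using t
proof (induction t rule: dec_induct)
  case base
  \<comment> \<open>At \<open>t = 1\<close> the bound follows from
    \<open>\<kappa> \<le> (2/3) powr \<nu>\<close>. The right side is at least 2/3 as
    \<open>\<nu> \<le> 1\<close>, and \<open>3 * \<kappa> \<le> 2 - \<nu>\<close> gives
    \<open>\<kappa> \<le> 2/3\<close>.\<close>
  have "(2 / 3 :: real) powr 1 \<le> (2 / 3) powr \<nu>"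
    using nu by (intro powr_mono') auto
  then have "2 / 3 \<le> 2 powr \<nu> / (3 :: real) powr \<nu>"
    by (simp only: powr_divide) simp
  then have "\<kappa> \<le> 2 powr \<nu> / 3 powr \<nu>"
    using k nu by linarith
  then have "2 * B * \<kappa> \<le> 2 * B * (2 powr \<nu> / 3 powr \<nu>)"
    using B by (intro mult_left_mono) auto
  then have "2 * B \<le> 2 powr (1 + \<nu>) * B / \<kappa> / 3 powr \<nu>"
    using k by (simp add: field_simps powr_add)
  then show ?case
    using \<open>h 1 \<le> 2 * B\<close> by simp
next
  case (step t)
  define s where "s = real t + 2"
  define K where "K = 2 powr (1 + \<nu>) * B / \<kappa>"
  have s: "s \<ge> 2" and K: "K \<ge> 0"
    using B k by (auto simp: s_def K_def)
  have g: "2 / (2 + real t) = 2 / s" by (simp add: s_def add.commute)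
  \<comment> \<open>The coefficient of \<open>h t\<close> must be nonnegative for the induction
    hypothesis to be inserted.\<close>
  have "(1 - \<kappa>) * 2 \<le> s"
    using s k by (simp add: algebra_simps)
  then have c: "0 \<le> 1 - (1 - \<kappa>) * (2 / s)"
    using s by (simp add: field_simps)
  have "h (Suc t) \<le> (1 - (1 - \<kappa>) * (2 / s)) * h t + (2 / s) powr (1 + \<nu>) * B"
    using assms(7)[OF step(1)] unfolding g .
  also have "\<dots> \<le> (1 - (1 - \<kappa>) * (2 / s)) * (K / s powr \<nu>) + (2 / s) powr (1 + \<nu>) * B"
    using step.IH c by (intro add_right_mono mult_left_mono) (auto simp: K_def s_def)
  \<comment> \<open>The factor \<open>1 / \<kappa>\<close> in \<open>K\<close> makes the error term
    exactly \<open>\<kappa> / s\<close> times the inductive bound. The net decrease factor is then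
    \<open>1 - (2 - 3 * \<kappa>) / s\<close>, and the parameter condition makes it at most
    \<open>1 - \<nu> / s\<close>.\<close>
  also have "(2 / s) powr (1 + \<nu>) * B = \<kappa> / s * (K / s powr \<nu>)"
    using s k by (simp add: K_def powr_divide powr_add field_simps)
  also have "(1 - (1 - \<kappa>) * (2 / s)) * (K / s powr \<nu>) + \<kappa> / s * (K / s powr \<nu>)
      = (1 - (2 - 3 * \<kappa>) / s) * (K / s powr \<nu>)"
    by (simp add: algebra_simps diff_divide_distrib add_divide_distrib)
  also have "\<dots> \<le> (1 - \<nu> / s) * (K / s powr \<nu>)"
    using s k K by (intro mult_right_mono) (auto simp: divide_right_mono)
  also have "\<dots> = K * ((1 - \<nu> / s) / s powr \<nu>)"
    by simp
  also have "\<dots> \<le> K * (1 / (s + 1) powr \<nu>)"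
    using s K nu by (intro mult_left_mono inverse_powr_step) auto
  finally show ?case by (simp add: K_def s_def add_ac)
qed

section \<open>Convergence of the Frank-Wolfe iterates\<close>

theorem theoremE3:
  fixes C P :: "'a::euclidean_space set"
    and \<phi> f :: "'a \<Rightarrow> ereal"
    and \<nu> L \<sigma> \<rho> \<mu> \<zeta> D :: real
    and \<gamma> :: "nat \<Rightarrow> real"
    and x v :: "nat \<Rightarrow> 'a"
  assumes C: "open C" "convex C" "C \<noteq> {}"
    and kernel: "kernel_generating_distance C \<phi>" "closure C = closure (edom \<phi>)"
      "strictly_econvex_on C \<phi>"
    and nu: "0 < \<nu>" "\<nu> \<le> 1"
      "\<forall>x\<in>C. \<forall>y\<in>C. \<forall>s\<in>{0..1}.
         bregman \<phi> ((1 - s) *\<^sub>R x + s *\<^sub>R y) x \<le> s powr (1 + \<nu>) * bregman \<phi> y x"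
    and f: "proper f" "lsc f" "edom \<phi> \<subseteq> edom f" "C1_on C f"
    and smad: "L > 0" "smooth_adaptable_on P L f \<phi>"
    and P: "P \<noteq> {}" "compact P" "convex P" "P \<subseteq> C"
    and strong: "\<sigma> > 0" "strongly_econvex \<sigma> \<phi>"
    and weak: "\<rho> > 0" "weakly_econvex \<rho> f"
    and growth: "\<mu> > 0" "\<zeta> > 0" "local_quadratic_growth \<mu> \<zeta> f P"
    and D: "D = bregman_diameter \<phi> P"
    and fw: "frank_wolfe f P \<gamma> x v" "\<forall>t. \<gamma> t = 2 / (2 + real t)"
    and local: "\<forall>t\<ge>1. f (x t) \<le> min_value f P + ereal \<zeta>"
    and params: "\<rho> / \<sigma> \<le> L" "3 * \<rho> / \<mu> \<le> 2 - \<nu>"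
  shows "(\<forall>t\<ge>1. f (x t) - min_value f P
            \<le> ereal (2 powr (1 + \<nu>) * \<mu> * L * D\<^sup>2 / (\<rho> * (real t + 2) powr \<nu>))) \<and>
         (\<forall>\<epsilon>>0. \<forall>t::nat. real t \<ge> (2 powr (1 + \<nu>) * \<mu> * L * D\<^sup>2 / (\<rho> * \<epsilon>)) powr (1 / \<nu>) \<longrightarrow>
            f (x t) - min_value f P \<le> ereal \<epsilon>)"
proof -
  \<comment> \<open>The estimates are carried out in the reals, since \<open>f\<close> is finite on
    \<open>C\<close> and hence on \<open>P\<close>. \<open>K\<close> is the constant of
    \<open>open_loop_recursion\<close>.\<close>
  define F where "F x = real_of_ereal (f x)" for x
  define h where "h t = F (x t) - real_of_ereal (min_value f P)" for t
  define K where "K = 2 powr (1 + \<nu>) * (L * D\<^sup>2) / (\<rho> / \<mu>)"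
  have C1: "C1_on C \<phi>" "C1_on C f"
    using kernel f by (auto simp: kernel_generating_distance_def)
  have fF: "f z = ereal (F z)" if "z \<in> P" for z
    using C1_on_ereal[OF C1(2)] that P(4) unfolding F_def by blast
  have contF: "continuous_on P F"
    unfolding F_def using C1_on_continuous_on[OF C1(2)] P(4) continuous_on_subset by blast
  obtain w where w: "w \<in> P" "\<And>z. z \<in> P \<Longrightarrow> F w \<le> F z"
    using continuous_attains_inf[OF P(2,1) contF] by blast
  have "min_value f P = f w"
    unfolding min_value_def using w fF by (intro antisym INF_lower INF_greatest) auto
  then have m: "min_value f P = ereal (F w)"
    using fF w by simp
  have X: "minimizers f P = {z \<in> P. F z \<le> F w}"
    unfolding minimizers_def is_arg_min_def using w fF
    by (auto simp: not_less) (meson order_trans)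
  \<comment> \<open>Closedness makes the distance to the minimizers attained, so quadratic growth
    can be read at an actual minimizer.\<close>
  have "closed (minimizers f P)"
    unfolding X using continuous_on_closed_Collect_le[OF contF continuous_on_const]
    by (simp add: P(2) compact_imp_closed)
  moreover have "w \<in> minimizers f P"
    unfolding X using w by simp
  ultimately have nearest: "\<exists>u\<in>minimizers f P. infdist z (minimizers f P) = dist z u" for z
    using infdist_attains_inf by (metis empty_iff)
  have bdd: "bdd_above ((\<lambda>(x, y). bregman \<phi> x y) ` (P \<times> P))"
    using bdd_above_bregman[OF C1(1) P(2,4)] .
  have breg: "bregman \<phi> y z \<le> D\<^sup>2" if "y \<in> P" "z \<in> P" for y z
    unfolding D using bregman_le_diameter_square[OF bdd that] .
  have strong': "\<sigma> / 2 * (norm (y - z))\<^sup>2 \<le> D\<^sup>2" if "y \<in> P" "z \<in> P" for y z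
    using strongly_econvex_bregman_ge[OF strong(2) C1(1) C(2)] breg[OF that] that P(4)
    by (meson order_trans subsetD)
  have weak': "F z + egrad f z \<bullet> (y - z) - \<rho> / 2 * (norm (y - z))\<^sup>2 \<le> F y"
    if "y \<in> P" "z \<in> P" for y z
    unfolding F_def using weakly_econvex_above_tangent[OF weak(2) C1(2) C(2)] that P(4) by blast
  have vP: "v t \<in> P" and vmin: "z \<in> P \<Longrightarrow> egrad f (x t) \<bullet> v t \<le> egrad f (x t) \<bullet> z"
    and g01: "\<gamma> t \<in> {0..1}"
    and xSuc: "x (Suc t) = (1 - \<gamma> t) *\<^sub>R x t + \<gamma> t *\<^sub>R v t" for t z
    using fw(1) by (auto simp: frank_wolfe_def minimizers_def is_arg_min_def not_less)
  have xP: "x t \<in> P" for t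
  proof (induction t)
    case 0
    then show ?case using fw(1) by (simp add: frank_wolfe_def)
  next
    case (Suc t)
    then show ?case using P(3) vP[of t] g01[of t] by (simp add: xSuc convex_alt)
  qed
  \<comment> \<open>The scaling property \<open>nu(3)\<close> extracts the power of
    \<open>\<gamma> t\<close> from the Bregman term, and the diameter bounds what remains.\<close>
  have descent: "F (x (Suc t)) \<le>
      F (x t) + \<gamma> t * (egrad f (x t) \<bullet> (v t - x t)) + \<gamma> t powr (1 + \<nu>) * (L * D\<^sup>2)" for t
  proof -
    have "bregman \<phi> (x (Suc t)) (x t) \<le> \<gamma> t powr (1 + \<nu>) * bregman \<phi> (v t) (x t)"
      unfolding xSuc using nu(3) xP[of t] vP[of t] g01[of t] P(4) by blast
    also have "\<dots> \<le> \<gamma> t powr (1 + \<nu>) * D\<^sup>2"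
      by (intro mult_left_mono breg vP xP) simp
    finally have "L * bregman \<phi> (x (Suc t)) (x t) \<le> L * (\<gamma> t powr (1 + \<nu>) * D\<^sup>2)"
      using smad(1) by simp
    moreover have "x (Suc t) - x t = \<gamma> t *\<^sub>R (v t - x t)"
      by (simp add: xSuc algebra_simps)
    ultimately show ?thesis
      using smooth_adaptable_descent[OF smad(2) C1(2,1) P(4) xP[of "Suc t"] xP[of t]]
      by (simp add: F_def mult_ac)
  qed
  \<comment> \<open>Optimality of \<open>v t\<close> lets any \<open>u\<close> in \<open>P\<close>
    replace it in the linear term, which weak convexity turns into function values. It is used with
    the nearest minimizer in \<open>step\<close> and with \<open>w\<close> in
    \<open>base\<close>.\<close>
  have gap: "egrad f (x t) \<bullet> (v t - x t) \<le> F u - F (x t) + \<rho> / 2 * (norm (u - x t))\<^sup>2"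
    if "u \<in> P" for t u
    using weak'[OF that xP[of t]] vmin[OF that, of t] by (simp add: inner_diff_right)
  have h: "h t = F (x t) - F w" for t
    by (simp add: h_def m)
  have step: "h (Suc t) \<le>
      (1 - (1 - \<rho> / \<mu>) * (2 / (2 + real t))) * h t + (2 / (2 + real t)) powr (1 + \<nu>) * (L * D\<^sup>2)"
    if "1 \<le> t" for t
  proof -
    obtain u where u: "u \<in> minimizers f P" "infdist (x t) (minimizers f P) = dist (x t) u"
      using nearest by blast
    have uP: "u \<in> P" "F u \<le> F w" using u(1) X by auto
    \<comment> \<open>By \<open>local\<close>, \<open>x t\<close> lies in the sublevel set where
      growth holds. The growth bound times \<open>\<rho> / 2\<close> costs
      \<open>\<rho> / \<mu>\<close> of \<open>h t\<close>, leaving the factor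
      \<open>1 - \<rho> / \<mu>\<close>.\<close>
    have "ereal ((dist (x t) u)\<^sup>2) \<le> ereal (2 / \<mu>) * (f (x t) - min_value f P)"
      using growth(3) local that xP[of t] u(2) unfolding local_quadratic_growth_def by metis
    then have "(norm (u - x t))\<^sup>2 \<le> 2 / \<mu> * h t"
      by (simp add: m fF[OF xP] h dist_norm norm_minus_commute)
    then have "\<rho> / 2 * (norm (u - x t))\<^sup>2 \<le> \<rho> / 2 * (2 / \<mu> * h t)"
      using weak(1) by (intro mult_left_mono) auto
    then have "egrad f (x t) \<bullet> (v t - x t) \<le> - (1 - \<rho> / \<mu>) * h t"
      using gap[OF uP(1), of t] uP(2) by (simp add: h algebra_simps)
    then have "\<gamma> t * (egrad f (x t) \<bullet> (v t - x t)) \<le> \<gamma> t * (- (1 - \<rho> / \<mu>) * h t)"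
      using g01[of t] by (intro mult_left_mono) auto
    then have "h (Suc t) \<le> (1 - (1 - \<rho> / \<mu>) * \<gamma> t) * h t + \<gamma> t powr (1 + \<nu>) * (L * D\<^sup>2)"
      using descent[of t] unfolding h by argo
    then show ?thesis using fw(2) by simp
  qed
  \<comment> \<open>Growth is available only from \<open>t = 1\<close> on, so the first step is
    bounded directly. As \<open>\<gamma> 0 = 1\<close>, the value \<open>F (x 0)\<close> cancels
    between \<open>descent\<close> and \<open>gap\<close>; strong convexity bounds the quadratic
    term left over by \<open>\<rho> / \<sigma> * D\<^sup>2\<close>.\<close>
  have base: "h 1 \<le> 2 * (L * D\<^sup>2)"
  proof -
    have "\<rho> / 2 * (norm (w - x 0))\<^sup>2 = \<rho> / \<sigma> * (\<sigma> / 2 * (norm (w - x 0))\<^sup>2)"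
      using strong(1) by simp
    also have "\<dots> \<le> L * D\<^sup>2"
      using strong'[OF w(1) xP[of 0]] params(1) strong(1) weak(1) smad(1)
      by (intro mult_mono) auto
    finally show ?thesis
      using descent[of 0] gap[OF w(1), of 0] fw(2) by (simp add: h)
  qed
  have rate: "h t \<le> K / (real t + 2) powr \<nu>" if "1 \<le> t" for t
    unfolding K_def using nu(1,2) params(2) weak(1) growth(1) smad(1) base step that
    by (intro open_loop_recursion) auto
  have K: "K = 2 powr (1 + \<nu>) * \<mu> * L * D\<^sup>2 / \<rho>"
    by (simp add: K_def)
  have K0: "0 \<le> K"
    using weak(1) growth(1) smad(1) by (simp add: K)
  have eq: "f (x t) - min_value f P = ereal (h t)" for t
    by (simp add: m fF[OF xP] h)
  have "h t \<le> \<epsilon>" if eps: "0 < \<epsilon>" and t: "(K / \<epsilon>) powr (1 / \<nu>) \<le> real t" for \<epsilon> t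
  proof (cases "t = 0")
    case True
    \<comment> \<open>A real power is positive unless its base is 0, so a threshold of at most 0
      forces \<open>K\<close> to vanish.\<close>
    then have "K = 0"
      using t eps by (auto simp: powr_le_cancel_iff)
    then have "D = 0"
      using weak(1) growth(1) smad(1) by (simp add: K)
    txt \<open>The rate says nothing at \<open>t = 0\<close>, but \<open>P\<close> is a singleton here.\<close>
    then have "x 0 = w"
      using strong'[OF xP[of 0] w(1)] strong(1) by (simp add: mult_le_0_iff)
    then show ?thesis using True eps by (simp add: h)
  next
    case False
    have "K / \<epsilon> = ((K / \<epsilon>) powr (1 / \<nu>)) powr \<nu>"
      using nu(1) K0 eps by (simp add: powr_powr)
    also have "\<dots> \<le> (real t + 2) powr \<nu>"
      using t nu(1) by (intro powr_mono2) auto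
    finally have "K / (real t + 2) powr \<nu> \<le> \<epsilon>"
      using eps by (simp add: field_simps)
    then show ?thesis using rate[of t] False by simp
  qed
  then show ?thesis
    using rate by (simp add: eq K)
qed

end
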